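(* For every integer $N\geq 0$, $$B_{2N+2}=\frac{\Gamma(3+2N)}{2^{2N}(2^{2N+2}-1)}\sum_{k=0}^{N-1}\frac{2^{2k}\,(1-2^{2k+2})\,B_{2k+2}}{\Gamma(1-2k+2N)\,\Gamma(2k+3)}+\frac{1+N}{2^{2N+1}(2^{2N+2}-1)}.$$
   Context: $B_n$ denotes the $n$-th Bernoulli number ($x/(e^x-1)=\sum_{n\ge 0}B_nx^n/n!$). A sum whose lower limit exceeds its upper limit is zero. *)

theory Defs
  imports "HOL-Analysis.Analysis" "HOL-Computational_Algebra.Formal_Power_Series"
begin

text \<open>
  Bernoulli numbers from the exponential generating function \<open>x / (e\<^sup>x - 1)\<close>, read as
  a formal power series. The denominator has no constant term, so it is not a unit;
  the quotient is nevertheless exact, as the lemma below confirms.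
\<close>

definition bernoulli :: "nat \<Rightarrow> real" where
  "bernoulli n = fact n * fps_nth (fps_X / (fps_exp 1 - 1)) n"

lemma bernoulli_gen_fun:
  "Abs_fps (\<lambda>n. bernoulli n / fact n) * (fps_exp 1 - 1) = (fps_X :: real fps)"
proof -
  have nth: "fps_nth (fps_exp (1::real) - 1) 1 \<noteq> 0"
    by simp
  then have nz: "fps_exp (1::real) - 1 \<noteq> 0"
    by (metis fps_zero_nth)
  have "subdegree (fps_exp (1::real) - 1) \<le> 1"
    using nth by (rule subdegree_leI)
  then have "(fps_exp (1::real) - 1) dvd fps_X"
    using nz by (simp add: fps_dvd_iff)
  moreover have "Abs_fps (\<lambda>n. bernoulli n / fact n) = fps_X / (fps_exp 1 - 1)"
    by (simp add: bernoulli_def fps_eq_iff)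
  ultimately show ?thesis
    by simp
qed

end

theory Submission
  imports Defs
begin

text \<open>
  After multiplying out the denominators and moving the term \<open>k = N\<close> into the sum, the
  recurrence says that
  \[ \sum_{k=0}^{N} \frac{2^{2k+2} (2^{2k+2} - 1) B_{2k+2}}{(2k+2)! \, (2N-2k)!}
     = \frac{1}{(2N+1)!}, \]
  which compares the coefficients of \<open>x\<^sup>2\<^sup>N\<^sup>+\<^sup>2\<close> in \<open>(x tanh x) cosh x = x sinh x\<close>. With
  \<open>G(x) = x / (e\<^sup>x - 1)\<close>, the series with coefficients \<open>2\<^sup>n (2\<^sup>n - 1) B\<^sub>n / n!\<close> is
  \<open>G(4x) - G(2x) = x tanh x - x\<close>; multiplied by \<open>2 cosh x\<close> it becomes \<open>- 2x e\<^sup>-\<^sup>x\<close>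
  (\<open>bernoulli_diff_times_cosh\<close>). Comparing coefficients in degree \<open>2N + 2\<close> gives the sum above
  (\<open>bernoulli_tanh_sum\<close>): as \<open>cosh\<close> is even, only Bernoulli numbers of even index occur there.
\<close>

lemma bernoulli_gen_fun_scaled:
  "Abs_fps (\<lambda>n. c ^ n * (bernoulli n / fact n)) * (fps_exp c - 1) = fps_const c * fps_X"
proof -
  let ?G = "Abs_fps (\<lambda>n. bernoulli n / fact n)" and ?cX = "fps_const c * fps_X :: real fps"
  have "(?G oo ?cX) * ((fps_exp 1 - 1) oo ?cX) = (?G * (fps_exp 1 - 1)) oo ?cX"
    by (rule fps_compose_mult_distrib[symmetric]) simp
  also have "\<dots> = ?cX"
    unfolding bernoulli_gen_fun by simp
  finally have "(?G oo ?cX) * ((fps_exp 1 - 1) oo ?cX) = ?cX" .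
  moreover have "(fps_exp 1 - 1) oo ?cX = fps_exp c - 1"
    by (simp add: fps_compose_sub_distrib)
  moreover have "?G oo ?cX = Abs_fps (\<lambda>n. c ^ n * (bernoulli n / fact n))"
    by (simp add: fps_compose_linear)
  ultimately show ?thesis
    by simp
qed

text \<open>
  The factor \<open>e\<^sup>2\<^sup>x - 1\<close> clears both denominators, because \<open>e\<^sup>4\<^sup>x - 1 = (e\<^sup>2\<^sup>x - 1) (e\<^sup>2\<^sup>x + 1)\<close>, and
  can be cancelled afterwards in the integral domain of power series.
\<close>

lemma bernoulli_diff_times_cosh:
  "Abs_fps (\<lambda>n. 2 ^ n * (2 ^ n - 1) * bernoulli n / fact n) * (fps_exp 1 + fps_exp (- 1))
    = - 2 * fps_X * fps_exp (- 1)"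
proof -
  define G4 G2 :: "real fps"
    where "G4 = Abs_fps (\<lambda>n. 4 ^ n * (bernoulli n / fact n))"
      and "G2 = Abs_fps (\<lambda>n. 2 ^ n * (bernoulli n / fact n))"
  define E D :: "real fps" where "E = fps_exp 1" and "D = fps_exp (- 1)"
  have split: "Abs_fps (\<lambda>n. 2 ^ n * (2 ^ n - 1) * bernoulli n / fact n) = G4 - G2"
  proof -
    have "(4::real) ^ n = 2 ^ n * 2 ^ n" for n
      by (simp flip: power_mult_distrib)
    then show ?thesis
      by (simp add: G4_def G2_def fps_eq_iff algebra_simps diff_divide_distrib)
  qed
  have E2: "fps_exp (2::real) = E * E" and E4: "fps_exp (4::real) = E * E * (E * E)"
    and ED: "E * D = 1"
    by (simp_all add: E_def D_def flip: fps_exp_add_mult)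
  have G4: "G4 * (E * E * (E * E) - 1) = 4 * fps_X"
    using bernoulli_gen_fun_scaled[of 4] by (simp add: G4_def E4 numeral_fps_const)
  have G2: "G2 * (E * E - 1) = 2 * fps_X"
    using bernoulli_gen_fun_scaled[of 2] by (simp add: G2_def E2 numeral_fps_const)
  have nz: "E * E - 1 \<noteq> 0"
    using G2 by (metis fps_X_neq_zero mult_eq_0_iff zero_neq_numeral)
  have "(E * E - 1) * ((G4 - G2) * (E * E + 1))
      = G4 * (E * E * (E * E) - 1) - G2 * (E * E - 1) * (E * E + 1)"
    by (simp add: algebra_simps)
  also have "\<dots> = (E * E - 1) * (- 2 * fps_X)"
    unfolding G4 G2 by (simp add: algebra_simps)
  finally have "(G4 - G2) * (E * E + 1) = - 2 * fps_X"
    using nz by (metis mult_left_cancel)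
  then have "(G4 - G2) * (E * E + 1) * D = - 2 * fps_X * D"
    by simp
  moreover have "(E * E + 1) * D = E + D"
    using ED by (simp add: algebra_simps)
  ultimately show ?thesis
    unfolding split by (simp add: E_def D_def mult.assoc)
qed

lemma sum_atMost_even:
  fixes f :: "nat \<Rightarrow> 'a :: comm_monoid_add"
  assumes "\<And>i. odd i \<Longrightarrow> i \<le> 2 * n \<Longrightarrow> f i = 0"
  shows "(\<Sum>i\<le>2 * n. f i) = (\<Sum>k\<le>n. f (2 * k))"
  using assms by (induction n) simp_all

lemma bernoulli_tanh_sum:
  "(\<Sum>k\<le>N. 2 ^ (2 * k + 2) * (2 ^ (2 * k + 2) - 1) * bernoulli (2 * k + 2)
      / (fact (2 * k + 2) * fact (2 * (N - k)))) = 1 / fact (2 * N + 1)"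
proof -
  define c where "c n = 2 ^ n * (2 ^ n - 1) * bernoulli n / fact n" for n
  \<comment> \<open>the factor \<open>1 + (- 1) ^ (2 * Suc N - i)\<close>, the parity of \<open>cosh\<close>, kills the odd \<open>i\<close>;
      the term \<open>i = 0\<close> vanishes because \<open>2 ^ 0 - 1 = 0\<close>\<close>
  define f where "f i = c i * ((1 + (- 1) ^ (2 * Suc N - i)) / fact (2 * Suc N - i))" for i
  have "(\<Sum>i\<le>2 * Suc N. f i)
      = fps_nth (Abs_fps c * (fps_exp 1 + fps_exp (- 1))) (2 * Suc N)"
    by (simp add: fps_mult_nth f_def atLeast0AtMost add_divide_distrib)
  also have "\<dots> = fps_nth (- 2 * fps_X * fps_exp (- 1)) (2 * Suc N)"
    using bernoulli_diff_times_cosh by (simp add: c_def[abs_def])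
  also have "\<dots> = 2 / fact (2 * N + 1)"
    by (simp add: mult.assoc numeral_fps_const fps_const_neg[symmetric] del: fps_const_neg)
      (simp add: algebra_simps)
  finally have total: "(\<Sum>i\<le>2 * Suc N. f i) = 2 / fact (2 * N + 1)" .
  have "(\<Sum>i\<le>2 * Suc N. f i) = (\<Sum>k\<le>Suc N. f (2 * k))"
    by (rule sum_atMost_even) (simp add: f_def)
  also have "\<dots> = (\<Sum>k\<le>N. f (2 * k + 2))"
    by (subst sum.atMost_Suc_shift) (simp add: f_def c_def)
  also have "\<dots> = (\<Sum>k\<le>N. 2 * (c (2 * k + 2) / fact (2 * (N - k))))"
  proof (rule sum.cong[OF refl])
    fix k
    have "2 * Suc N - (2 * k + 2) = 2 * (N - k)" by simp
    then show "f (2 * k + 2) = 2 * (c (2 * k + 2) / fact (2 * (N - k)))"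
      unfolding f_def by simp
  qed
  finally have "2 * (\<Sum>k\<le>N. c (2 * k + 2) / fact (2 * (N - k))) = 2 / fact (2 * N + 1)"
    unfolding total by (simp only: sum_distrib_left)
  then show ?thesis
    by (simp add: c_def)
qed

theorem mainTheorem3:
  fixes N :: nat
  shows "bernoulli (2 * N + 2) =
    Gamma (3 + 2 * real N) / (2 ^ (2 * N) * (2 ^ (2 * N + 2) - 1)) *
      (\<Sum>k<N. 2 ^ (2 * k) * (1 - 2 ^ (2 * k + 2)) * bernoulli (2 * k + 2) /
        (Gamma (1 - 2 * real k + 2 * real N) * Gamma (2 * real k + 3)))
    + (1 + real N) / (2 ^ (2 * N + 1) * (2 ^ (2 * N + 2) - 1))"
proof -
  define t where "t k = 2 ^ (2 * k + 2) * (2 ^ (2 * k + 2) - 1) * bernoulli (2 * k + 2)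
      / (fact (2 * k + 2) * fact (2 * (N - k)))" for k
  have Gamma_fact3: "Gamma (2 * real k + 3) = fact (2 * k + 2)" for k
    using Gamma_fact[of "2 * k + 2"] by (simp add: add_ac)
  have Gamma_fact1: "Gamma (1 - 2 * real k + 2 * real N) = fact (2 * (N - k))" if "k < N" for k
    using Gamma_fact[of "2 * (N - k)"] that by (simp add: of_nat_diff algebra_simps)
  have "(\<Sum>k<N. 2 ^ (2 * k) * (1 - 2 ^ (2 * k + 2)) * bernoulli (2 * k + 2) /
        (Gamma (1 - 2 * real k + 2 * real N) * Gamma (2 * real k + 3))) = (\<Sum>k<N. - t k / 4)"
  proof (rule sum.cong[OF refl])
    fix k assume "k \<in> {..<N}"
    then have "k < N" by simp
    have "(2::real) ^ (2 * k + 2) = 4 * 2 ^ (2 * k)" by simp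
    then show "2 ^ (2 * k) * (1 - 2 ^ (2 * k + 2)) * bernoulli (2 * k + 2) /
        (Gamma (1 - 2 * real k + 2 * real N) * Gamma (2 * real k + 3)) = - t k / 4"
      unfolding Gamma_fact1[OF \<open>k < N\<close>] Gamma_fact3 t_def
      by (simp add: divide_simps del: fact_Suc) (simp add: algebra_simps del: fact_Suc)
  qed
  also have "\<dots> = - (\<Sum>k<N. t k) / 4"
    by (simp add: sum_negf flip: sum_divide_distrib)
  also have "(\<Sum>k<N. t k) = 1 / fact (2 * N + 1) - t N"
    using bernoulli_tanh_sum[of N] by (simp add: t_def lessThan_Suc_atMost[symmetric])
  finally have S: "(\<Sum>k<N. 2 ^ (2 * k) * (1 - 2 ^ (2 * k + 2)) * bernoulli (2 * k + 2) /
        (Gamma (1 - 2 * real k + 2 * real N) * Gamma (2 * real k + 3)))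
      = (t N - 1 / fact (2 * N + 1)) / 4"
    by simp
  define p q F :: real
    where "p = 2 ^ (2 * N)" and "q = 2 ^ (2 * N + 2) - 1" and "F = fact (2 * N + 1)"
  have pos: "p > 0" "F > 0"
    by (simp_all add: p_def F_def)
  have "(2::real) ^ (2 * N + 2) > 1"
    by (rule one_less_power) simp_all
  then have q: "q > 0"
    by (simp add: q_def)
  have F2: "fact (2 * N + 2) = 2 * (1 + real N) * F"
    by (simp add: F_def algebra_simps)
  have t: "t N = 4 * p * q * bernoulli (2 * N + 2) / (2 * (1 + real N) * F)"
    unfolding t_def F2 by (simp add: p_def q_def)
  have G: "Gamma (3 + 2 * real N) = 2 * (1 + real N) * F"
    using Gamma_fact3[of N] unfolding F2 by (simp add: add.commute)
  have p2: "(2::real) ^ (2 * N + 1) = 2 * p"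
    by (simp add: p_def)
  have "1 + real N \<noteq> 0"
    by simp
  then show ?thesis
    unfolding S t G p2 unfolding p_def[symmetric] q_def[symmetric] F_def[symmetric]
    using pos q by (simp add: divide_simps)
qed

end
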